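(* Let $a,b,c\in\mathbb{R}$ with $a\neq0$, let $g:\mathbb{R}\to\mathbb{R}$, $g(x)=ax^2+bx+c$, let $\delta:=b^2-4ac-2b-7$, and assume $\delta\ge0$. Then: (i) If $\delta=0$, the 3-cycle $\mathcal{C}_{\langle0\rangle}$ of the map $x_{t+1}=g(x_t)$ is nonhyperbolic. (ii) If $\delta>0$, the 3-cycle $\mathcal{C}_{\langle-\delta\rangle}$ is hyperbolic, while $\mathcal{C}_{\langle\delta\rangle}$ is nonhyperbolic if and only if $$\delta=\delta_{nh}:=\frac{\left(\left(460+60\sqrt{201}\right)^{\frac{2}{3}}-2\left(460+60\sqrt{201}\right)^{\frac{1}{3}}-80\right)^{2}}{36\left(460+60\sqrt{201}\right)^{\frac{2}{3}}}\approx0.074.$$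
   Context: A 3-cycle of the map $x_{t+1}=g(x_t)$ is the class, modulo cyclic permutation, of an ordered triple $(x,y,z)$ of pairwise distinct real numbers with $g(x)=y$, $g(y)=z$, $g(z)=x$; its points are $x,y,z$. A 3-cycle with points $x,y,z$ is hyperbolic if $|g'(x)g'(y)g'(z)|\neq1$, and nonhyperbolic otherwise. For $\beta\in\mathbb{R}$ let $Q_\beta(X)=X^3+(1-\beta)X^2-(2+\beta)X-1$. All roots of $Q_\beta$ are real, distinct and nonzero; they are denoted $q^{\langle\beta\rangle}_1<q^{\langle\beta\rangle}_2<q^{\langle\beta\rangle}_3$. For $\delta=0$ the map has a unique 3-cycle $\mathcal{C}_{\langle0\rangle}$, whose points are $\frac{-b+1}{2a}+\frac{1}{a q^{\langle0\rangle}_i}$, $i\in\{1,2,3\}$. For $\delta>0$ the map has exactly two 3-cycles: $\mathcal{C}_{\langle\delta\rangle}$, whose points are $\frac{-b+\sqrt{\delta}+1}{2a}+\frac{1}{a q^{\langle\sqrt{\delta}\rangle}_i}$, and $\mathcal{C}_{\langle-\delta\rangle}$, whose points are $\frac{-b-\sqrt{\delta}+1}{2a}+\frac{1}{a q^{\langle-\sqrt{\delta}\rangle}_i}$, $i\in\{1,2,3\}$. *)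

theory Defs
  imports "HOL-Analysis.Analysis" "HOL-Computational_Algebra.Polynomial"
begin

definition cyclic_class :: "real \<Rightarrow> real \<Rightarrow> real \<Rightarrow> (real \<times> real \<times> real) set" where
  "cyclic_class x y z = {(x, y, z), (y, z, x), (z, x, y)}"

definition three_cycle :: "(real \<Rightarrow> real) \<Rightarrow> (real \<times> real \<times> real) set \<Rightarrow> bool" where
  "three_cycle g C \<longleftrightarrow>
     (\<exists>x y z. x \<noteq> y \<and> y \<noteq> z \<and> x \<noteq> z \<and> g x = y \<and> g y = z \<and> g z = x \<and> C = cyclic_class x y z)"

definition cycle_points :: "(real \<times> real \<times> real) set \<Rightarrow> real set" where
  "cycle_points C = (\<Union>(x, y, z)\<in>C. {x, y, z})"

definition hyperbolic_cycle :: "(real \<Rightarrow> real) \<Rightarrow> (real \<times> real \<times> real) set \<Rightarrow> bool" where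
  "hyperbolic_cycle g C \<longleftrightarrow> three_cycle g C \<and>
     (\<forall>(x, y, z)\<in>C. \<bar>deriv g x * deriv g y * deriv g z\<bar> \<noteq> 1)"

definition nonhyperbolic_cycle :: "(real \<Rightarrow> real) \<Rightarrow> (real \<times> real \<times> real) set \<Rightarrow> bool" where
  "nonhyperbolic_cycle g C \<longleftrightarrow> three_cycle g C \<and> \<not> hyperbolic_cycle g C"

definition Q :: "real \<Rightarrow> real poly" where
  "Q \<beta> = [:-1, -(2 + \<beta>), 1 - \<beta>, 1:]"

text \<open>\<open>q \<beta> i\<close> is the \<open>i\<close>-th smallest root of \<open>Q \<beta>\<close>, for \<open>i \<in> {1, 2, 3}\<close>.\<close>

definition q :: "real \<Rightarrow> nat \<Rightarrow> real" where
  "q \<beta> i = sorted_list_of_set {x. poly (Q \<beta>) x = 0} ! (i - 1)"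

definition C_points :: "real \<Rightarrow> real \<Rightarrow> real \<Rightarrow> real set" where
  "C_points a b \<beta> = (\<lambda>i. (- b + \<beta> + 1) / (2 * a) + 1 / (a * q \<beta> i)) ` {1, 2, 3}"

text \<open>
  \<open>C_cycle g a b \<epsilon>\<close> is the cycle written \<open>C\<close> with subscript \<open>\<langle>\<epsilon>\<rangle>\<close>, where \<open>\<epsilon>\<close> is \<open>0\<close>,
  \<open>\<delta>\<close> or \<open>-\<delta>\<close>: the parameter \<open>\<beta>\<close> is \<open>0\<close>, \<open>sqrt \<delta>\<close> or \<open>- sqrt \<delta>\<close> respectively.
  That \<open>g\<close> has exactly one such 3-cycle is \<open>C_cycle_ex1\<close> below.
\<close>

definition C_cycle :: "(real \<Rightarrow> real) \<Rightarrow> real \<Rightarrow> real \<Rightarrow> real \<Rightarrow> (real \<times> real \<times> real) set" where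
  "C_cycle g a b \<epsilon> =
     (THE C. three_cycle g C \<and> cycle_points C = C_points a b (sgn \<epsilon> * sqrt \<bar>\<epsilon>\<bar>))"

definition \<delta>\<^sub>n\<^sub>h :: real where
  "\<delta>\<^sub>n\<^sub>h =
     ((460 + 60 * sqrt 201) powr (2/3) - 2 * (460 + 60 * sqrt 201) powr (1/3) - 80)\<^sup>2
       / (36 * (460 + 60 * sqrt 201) powr (2/3))"

lemma poly_Q: "poly (Q \<beta>) x = x^3 + (1 - \<beta>) * x^2 - (2 + \<beta>) * x - 1"
  by (simp add: Q_def algebra_simps power2_eq_square power3_eq_cube)

lemma Q_roots:
  obtains u v w where "u < -1" "-1 < v" "v < 0" "0 < w"
    "{x. poly (Q \<beta>) x = 0} = {u, v, w}" "q \<beta> 1 = u" "q \<beta> 2 = v" "q \<beta> 3 = w"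
proof -
  have m1: "poly (Q \<beta>) (-1) = 1" and z: "poly (Q \<beta>) 0 = -1"
    by (simp_all add: poly_Q)
  define M where "M = 4 + \<bar>\<beta>\<bar>"
  have "M^3 + (1 - \<beta>) * M^2 - (2 + \<beta>) * M - 1 > 0 \<and> (-M)^3 + (1 - \<beta>) * (-M)^2 - (2 + \<beta>) * (-M) - 1 < 0"
  proof -
    define t where "t = \<bar>\<beta>\<bar>"
    have t: "t \<ge> 0" by (simp add: t_def)
    have M2: "M = 4 + t" by (simp add: M_def t_def)
    have a: "\<beta> * M^2 \<le> t * M^2" "- \<beta> * M^2 \<le> t * M^2" "\<beta> * M \<le> t * M" "- \<beta> * M \<le> t * M"
      using M2 t by (intro mult_right_mono; simp add: t_def)+
    have b: "M^3 = 4 * M^2 + t * M^2" "M^2 = 4 * M + t * M"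
      by (auto simp: M2 power2_eq_square power3_eq_cube algebra_simps)
    have c: "M \<ge> 4" "t * M \<ge> 0" using M2 t by auto
    have d: "(-M)^3 = - (M^3)" "(-M)^2 = M^2" by auto
    have e: "(1 - \<beta>) * M^2 = M^2 - \<beta> * M^2" "(2 + \<beta>) * M = 2 * M + \<beta> * M"
       "(2 + \<beta>) * (-M) = - 2 * M - \<beta> * M"
      by (auto simp: algebra_simps)
    show ?thesis unfolding d e using a b c by linarith
  qed
  then have pM: "poly (Q \<beta>) M > 0" and nM: "poly (Q \<beta>) (-M) < 0"
    by (simp_all add: poly_Q)
  have M: "M > 0" "-M < -1" by (auto simp: M_def)
  obtain u where u: "u < -1" "poly (Q \<beta>) u = 0"
    using poly_IVT_pos[OF M(2) nM] m1 by auto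
  obtain v where v: "-1 < v" "v < 0" "poly (Q \<beta>) v = 0"
    using poly_IVT_neg[of "-1" 0 "Q \<beta>"] m1 z by auto
  obtain w where w: "0 < w" "poly (Q \<beta>) w = 0"
    using poly_IVT_pos[OF M(1) _ pM] z by auto
  have nz: "Q \<beta> \<noteq> 0" by (simp add: Q_def)
  have fin: "finite {x. poly (Q \<beta>) x = 0}" using poly_roots_finite[OF nz] .
  have "card {x. poly (Q \<beta>) x = 0} \<le> degree (Q \<beta>)"
    using card_poly_roots_bound[OF nz] .
  also have "degree (Q \<beta>) = 3" by (simp add: Q_def)
  finally have "card {x. poly (Q \<beta>) x = 0} \<le> card {u, v, w}" using u v w by auto
  then have eq: "{x. poly (Q \<beta>) x = 0} = {u, v, w}"
    using card_seteq[OF fin, of "{u, v, w}"] u v w by auto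
  have sl: "sorted_list_of_set {x. poly (Q \<beta>) x = 0} = [u, v, w]"
    using sorted_list_of_set.idem_if_sorted_distinct[of "[u, v, w]"] eq u v w by simp
  show thesis
    by (rule that[OF u(1) v(1,2) w(1) eq]) (simp_all add: q_def sl)
qed

lemma Q_root_step:
  assumes "poly (Q \<beta>) x = 0" "x \<noteq> 0"
  shows "poly (Q \<beta>) (- 1 - 1 / x) = 0"
proof -
  have "x^3 * poly (Q \<beta>) (- 1 - 1 / x) = poly (Q \<beta>) x"
    using assms(2) by (simp add: poly_Q field_simps power2_eq_square power3_eq_cube)
  then show ?thesis using assms by auto
qed

lemma g_step:
  fixes a b c \<beta> x :: real
  assumes "a \<noteq> 0" "\<beta>^2 = b^2 - 4 * a * c - 2 * b - 7" "poly (Q \<beta>) x = 0" "x \<noteq> 0" "x \<noteq> -1"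
  defines "p \<equiv> \<lambda>x. (- b + \<beta> + 1) / (2 * a) + 1 / (a * x)"
  shows "a * (p x)^2 + b * p x + c = p (- 1 - 1 / x)"
proof -
  define r where "r = 1 / x"
  define r' where "r' = 1 / (- 1 - 1 / x)"
  define K where "K = - b + \<beta> + 1"
  have ne: "- 1 - 1 / x \<noteq> 0" using assms(4,5) by (simp add: field_simps)
  have "r' = - x / (x + 1)" using assms(4,5) ne by (simp add: r'_def field_simps)
  moreover have "r^2 + (\<beta> + 1) * r - 2 + x / (x + 1) = 0"
  proof -
    have x1: "x + 1 \<noteq> 0" using assms(5) by simp
    have e: "x * r = 1" "(x + 1) * (x / (x + 1)) = x" using assms(4) x1 by (simp_all add: r_def)
    have "x^2 * (x + 1) * (r^2 + (\<beta> + 1) * r - 2 + x / (x + 1)) =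
        (x * r)^2 * (x + 1) + (\<beta> + 1) * (x * r) * x * (x + 1) - 2 * x^2 * (x + 1)
          + x^2 * ((x + 1) * (x / (x + 1)))"
      by (simp add: algebra_simps power2_eq_square del: times_divide_eq_left times_divide_eq_right)
    also have "\<dots> = - poly (Q \<beta>) x"
      unfolding e by (simp add: poly_Q algebra_simps power2_eq_square power3_eq_cube)
    finally show ?thesis using assms(3,4) x1 by simp
  qed
  ultimately have r': "r' = r^2 + (\<beta> + 1) * r - 2" by simp
  have p1: "p x = (K + 2 * r) / (2 * a)"
    using assms(1,4) by (simp add: p_def r_def K_def field_simps)
  have "p (- 1 - 1 / x) = K / (2 * a) + r' / a"
    by (simp add: p_def r'_def K_def)
  then have p2: "p (- 1 - 1 / x) = (K + 2 * r') / (2 * a)"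
    using assms(1) by (simp add: field_simps)
  have ac: "4 * a * c = b^2 - 2 * b - 7 - \<beta>^2" using assms(2) by simp
  have "4 * a * (a * (p x)^2 + b * p x + c) = (K + 2 * r)^2 + 2 * b * (K + 2 * r) + 4 * a * c"
    using assms(1) by (simp add: p1 field_simps power2_eq_square)
  also have "\<dots> = 2 * (K + 2 * r')"
    unfolding ac r' K_def by (simp add: algebra_simps power2_eq_square)
  also have "\<dots> = 4 * a * p (- 1 - 1 / x)" using assms(1) by (simp add: p2)
  finally show ?thesis using assms(1) by simp
qed

lemma C_cycle_ex1:
  fixes a b c \<beta> :: real
  assumes "a \<noteq> 0" "\<beta>^2 = b^2 - 4 * a * c - 2 * b - 7"
  shows "\<exists>!C. three_cycle (\<lambda>x. a * x^2 + b * x + c) C \<and> cycle_points C = C_points a b \<beta>"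
proof -
  define g where "g = (\<lambda>x. a * x^2 + b * x + c)"
  define p where "p = (\<lambda>x. (- b + \<beta> + 1) / (2 * a) + 1 / (a * x))"
  obtain u v w where uvw: "u < -1" "-1 < v" "v < 0" "0 < w"
    and roots: "{x. poly (Q \<beta>) x = 0} = {u, v, w}"
    and q: "q \<beta> 1 = u" "q \<beta> 2 = v" "q \<beta> 3 = w" by (rule Q_roots)
  have root: "poly (Q \<beta>) x = 0 \<longleftrightarrow> x = u \<or> x = v \<or> x = w" for x
    using roots by blast
  have step: "poly (Q \<beta>) (- 1 - 1 / x) = 0" if "x = u \<or> x = v \<or> x = w" for x
  proof (rule Q_root_step)
    show "poly (Q \<beta>) x = 0" using that root[of x] by blast
    show "x \<noteq> 0" using that uvw by linarith
  qed
  have gp: "g (p x) = p (- 1 - 1 / x)" if "x = u \<or> x = v \<or> x = w" for x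
    unfolding g_def p_def
  proof (rule g_step[OF assms])
    show "poly (Q \<beta>) x = 0" using that root[of x] by blast
    show "x \<noteq> 0" "x \<noteq> -1" using that uvw by linarith+
  qed
  have "- 1 - 1 / u < 0" "- 1 - 1 / u > -1" using uvw by (auto simp: field_simps)
  then have u': "- 1 - 1 / u = v" using step[of u] root[of "- 1 - 1 / u"] uvw by linarith
  have "- 1 - 1 / v > 0" using uvw by (auto simp: field_simps)
  then have v': "- 1 - 1 / v = w" using step[of v] root[of "- 1 - 1 / v"] uvw by linarith
  have "- 1 - 1 / w < -1" using uvw by (auto simp: field_simps)
  then have w': "- 1 - 1 / w = u" using step[of w] root[of "- 1 - 1 / w"] uvw by linarith
  have g: "g (p u) = p v" "g (p v) = p w" "g (p w) = p u"
    using gp[of u] gp[of v] gp[of w] u' v' w' by auto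
  have inj: "p x = p y \<longleftrightarrow> x = y" if "x \<noteq> 0" "y \<noteq> 0" for x y
    using that assms(1) by (auto simp: p_def)
  have ne: "p u \<noteq> p v" "p v \<noteq> p w" "p u \<noteq> p w" using inj uvw by auto
  have pts: "C_points a b \<beta> = {p u, p v, p w}"
    unfolding C_points_def p_def by (simp only: image_insert image_empty q)
  have cp: "cycle_points (cyclic_class x y z) = {x, y, z}" for x y z
    by (auto simp: cycle_points_def cyclic_class_def)
  have "\<exists>!C. three_cycle g C \<and> cycle_points C = C_points a b \<beta>"
  proof (rule ex1I[of _ "cyclic_class (p u) (p v) (p w)"])
    show "three_cycle g (cyclic_class (p u) (p v) (p w)) \<and>
          cycle_points (cyclic_class (p u) (p v) (p w)) = C_points a b \<beta>"
      unfolding three_cycle_def cp pts using ne g by blast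
  next
    fix D assume D: "three_cycle g D \<and> cycle_points D = C_points a b \<beta>"
    then obtain x y z where xyz: "g x = y" "g y = z" "D = cyclic_class x y z"
      unfolding three_cycle_def by blast
    then have "x \<in> {p u, p v, p w}" using D unfolding pts by (auto simp: cp)
    then show "D = cyclic_class (p u) (p v) (p w)"
      using xyz g by (auto simp: cyclic_class_def)
  qed
  then show ?thesis by (simp add: g_def)
qed

end

theory Submission
  imports Defs
begin

text \<open>
  At the cycle point belonging to a root \<open>x\<close> of \<open>Q \<beta>\<close> the derivative of \<open>g\<close> is \<open>\<beta> + 1 + 2 / x\<close>, so by
  Vieta's formulas the multiplier of the cycle is \<open>1 - 7 * \<beta> - \<beta>\<^sup>2 - \<beta>\<^sup>3\<close>. It equals \<open>1\<close> only for
  \<open>\<beta> = 0\<close>, and \<open>-1\<close> only at the unique real root of \<open>\<beta>\<^sup>3 + \<beta>\<^sup>2 + 7 * \<beta> - 2\<close>, which is positive and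
  whose square is, by Cardano's formula, \<open>\<delta>\<^sub>n\<^sub>h\<close>.
\<close>

text \<open>Subtracting the equations of two roots and cancelling their nonzero difference leaves a
  quadratic relation. Subtracting two such relations yields \<open>A\<close>, and back substitution
  yields \<open>B\<close> and \<open>C\<close>.\<close>

lemma monic_cubic_vieta:
  fixes u v w A B C :: "'a::idom"
  assumes "u \<noteq> v" "v \<noteq> w" "u \<noteq> w"
    and "u^3 + A * u^2 + B * u + C = 0" "v^3 + A * v^2 + B * v + C = 0" "w^3 + A * w^2 + B * w + C = 0"
  shows "u + v + w = - A" "u * v + v * w + w * u = B" "u * v * w = - C"
proof -
  have divided_difference: "x^2 + x * y + y^2 + A * (x + y) + B = 0"
    if "x \<noteq> y" "x^3 + A * x^2 + B * x + C = 0" "y^3 + A * y^2 + B * y + C = 0" for x y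
  proof -
    have "(x - y) * (x^2 + x * y + y^2 + A * (x + y) + B) =
        (x^3 + A * x^2 + B * x + C) - (y^3 + A * y^2 + B * y + C)"
      by (simp add: algebra_simps power2_eq_square power3_eq_cube)
    then show ?thesis using that by simp
  qed
  note uv = divided_difference[OF assms(1,4,5)] and uw = divided_difference[OF assms(3,4,6)]
  have "(v - w) * (u + v + w + A) =
      (u^2 + u * v + v^2 + A * (u + v) + B) - (u^2 + u * w + w^2 + A * (u + w) + B)"
    by (simp add: algebra_simps power2_eq_square)
  then have "u + v + w + A = 0" using uv uw assms(2) by simp
  then show e1: "u + v + w = - A" by (simp add: eq_neg_iff_add_eq_0)
  then have A: "A = - (u + v + w)" by simp
  have "B - (u * v + v * w + w * u) = u^2 + u * v + v^2 + A * (u + v) + B"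
    unfolding A by (simp add: algebra_simps power2_eq_square)
  then show e2: "u * v + v * w + w * u = B" using uv by simp
  have "C + u * v * w = u^3 + A * u^2 + B * u + C"
    unfolding A e2[symmetric] by (simp add: algebra_simps power2_eq_square power3_eq_cube)
  then show "u * v * w = - C" using assms(4) by (simp add: eq_neg_iff_add_eq_0 add.commute)
qed

lemma deriv_quadratic:
  fixes a b c x :: real
  shows "deriv (\<lambda>x. a * x\<^sup>2 + b * x + c) x = 2 * a * x + b"
  by (rule DERIV_imp_deriv) (auto intro!: derivative_eq_intros)

lemma cycle_points_cyclic_class: "cycle_points (cyclic_class x y z) = {x, y, z}"
  by (auto simp: cycle_points_def cyclic_class_def)

text \<open>The multiplier is invariant under cyclic shifts, and the points are distinct, so the
  product over the set counts each once. Hyperbolicity can thus be read off from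
  \<open>cycle_points\<close>, which is what characterises \<open>C_cycle\<close>.\<close>

lemma hyperbolic_cycle_iff_prod:
  assumes "three_cycle g C"
  shows "hyperbolic_cycle g C \<longleftrightarrow> \<bar>\<Prod>t\<in>cycle_points C. deriv g t\<bar> \<noteq> 1"
proof -
  obtain x y z where xyz: "x \<noteq> y" "y \<noteq> z" "x \<noteq> z" "C = cyclic_class x y z"
    using assms unfolding three_cycle_def by blast
  then have "(\<Prod>t\<in>cycle_points C. deriv g t) = deriv g x * deriv g y * deriv g z"
    by (simp add: cycle_points_cyclic_class)
  then show ?thesis
    using assms xyz(4) unfolding hyperbolic_cycle_def
    by (simp add: cyclic_class_def mult.commute mult.left_commute)
qed

lemma prod_deriv_C_points:
  fixes a b c \<beta> :: real
  assumes "a \<noteq> 0"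
  shows "(\<Prod>t\<in>C_points a b \<beta>. deriv (\<lambda>x. a * x\<^sup>2 + b * x + c) t) = 1 - 7 * \<beta> - \<beta>^2 - \<beta>^3"
proof -
  define p where "p = (\<lambda>x. (- b + \<beta> + 1) / (2 * a) + 1 / (a * x))"
  obtain u v w where uvw: "u < -1" "-1 < v" "v < 0" "0 < w"
    and roots: "{x. poly (Q \<beta>) x = 0} = {u, v, w}"
    and q: "q \<beta> 1 = u" "q \<beta> 2 = v" "q \<beta> 3 = w" by (rule Q_roots)
  have root: "x^3 + (1 - \<beta>) * x^2 + (- (2 + \<beta>)) * x + (- 1) = 0" if "x \<in> {u, v, w}" for x
  proof -
    have "poly (Q \<beta>) x = 0" using that roots by blast
    then show ?thesis by (simp add: poly_Q algebra_simps)
  qed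
  have distinct: "u \<noteq> v" "v \<noteq> w" "u \<noteq> w" using uvw by auto
  have vieta: "u + v + w = \<beta> - 1" "u * v + v * w + w * u = - (2 + \<beta>)" "u * v * w = 1"
    using monic_cubic_vieta[OF distinct root root root] by auto
  have pts: "C_points a b \<beta> = {p u, p v, p w}"
    unfolding C_points_def p_def by (simp only: image_insert image_empty q)
  have ne: "p u \<noteq> p v" "p v \<noteq> p w" "p u \<noteq> p w" using assms uvw by (auto simp: p_def)
  \<comment> \<open>Over the common denominator \<open>x\<close>, the three slopes multiply to a
    fraction with denominator \<open>u * v * w = 1\<close>.\<close>
  have slope: "deriv (\<lambda>x. a * x\<^sup>2 + b * x + c) (p x) = ((\<beta> + 1) * x + 2) / x" if "x \<noteq> 0" for x
    unfolding deriv_quadratic using assms that by (simp add: p_def field_simps)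
  have "(\<Prod>t\<in>C_points a b \<beta>. deriv (\<lambda>x. a * x\<^sup>2 + b * x + c) t) =
      ((\<beta> + 1) * u + 2) * ((\<beta> + 1) * v + 2) * ((\<beta> + 1) * w + 2) / (u * v * w)"
    unfolding pts using ne uvw by (simp add: slope)
  also have "\<dots> = ((\<beta> + 1) * u + 2) * ((\<beta> + 1) * v + 2) * ((\<beta> + 1) * w + 2)"
    by (simp add: vieta(3))
  also have "\<dots> = (\<beta> + 1)^3 * (u * v * w) + 2 * (\<beta> + 1)^2 * (u * v + v * w + w * u)
      + 4 * (\<beta> + 1) * (u + v + w) + 8"
    by (simp add: algebra_simps power2_eq_square power3_eq_cube)
  also have "\<dots> = 1 - 7 * \<beta> - \<beta>^2 - \<beta>^3"
    unfolding vieta by (simp add: algebra_simps power2_eq_square power3_eq_cube)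
  finally show ?thesis .
qed

text \<open>The signed parameter \<epsilon> covers all three cycles at once. By the uniqueness in
  \<open>C_cycle_ex1\<close>, the definite description has its defining properties.\<close>

lemma C_cycle_hyperbolic_iff:
  fixes a b c \<epsilon> :: real
  defines "g \<equiv> \<lambda>x. a * x\<^sup>2 + b * x + c" and "\<beta> \<equiv> sgn \<epsilon> * sqrt \<bar>\<epsilon>\<bar>"
  assumes "a \<noteq> 0" "\<bar>\<epsilon>\<bar> = b\<^sup>2 - 4 * a * c - 2 * b - 7"
  shows "three_cycle g (C_cycle g a b \<epsilon>)"
    and "hyperbolic_cycle g (C_cycle g a b \<epsilon>) \<longleftrightarrow> \<bar>1 - 7 * \<beta> - \<beta>^2 - \<beta>^3\<bar> \<noteq> 1"
proof -
  have "\<beta>^2 = b\<^sup>2 - 4 * a * c - 2 * b - 7"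
    using assms(4) by (cases "\<epsilon> = 0") (auto simp: \<beta>_def power_mult_distrib sgn_if)
  from theI'[OF C_cycle_ex1[OF assms(3) this]]
  have cyc: "three_cycle g (C_cycle g a b \<epsilon>)"
    and pts: "cycle_points (C_cycle g a b \<epsilon>) = C_points a b \<beta>"
    unfolding C_cycle_def g_def \<beta>_def by blast+
  show "three_cycle g (C_cycle g a b \<epsilon>)" by (fact cyc)
  show "hyperbolic_cycle g (C_cycle g a b \<epsilon>) \<longleftrightarrow> \<bar>1 - 7 * \<beta> - \<beta>^2 - \<beta>^3\<bar> \<noteq> 1"
    unfolding hyperbolic_cycle_iff_prod[OF cyc] pts
    unfolding g_def prod_deriv_C_points[OF assms(3)] ..
qed

lemma multiplier_strict_antimono:
  fixes x y :: real
  assumes "x < y"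
  shows "1 - 7 * y - y^2 - y^3 < 1 - 7 * x - x^2 - x^3"
proof -
  \<comment> \<open>The difference of the two values factors through \<open>y - x\<close>; the
    cofactor is positive as a sum of squares plus a constant.\<close>
  have "0 < (x + y + 1)^2 / 2 + x^2 / 2 + y^2 / 2 + 13/2"
    by (intro add_nonneg_pos add_nonneg_nonneg) auto
  also have "\<dots> = x^2 + x * y + y^2 + x + y + 7"
    by (simp add: power2_eq_square field_simps)
  finally have "0 < (y - x) * (x^2 + x * y + y^2 + x + y + 7)" using assms by simp
  then show ?thesis by (simp add: algebra_simps power2_eq_square power3_eq_cube)
qed

lemma multiplier_less_iff:
  fixes x y :: real
  shows "1 - 7 * y - y^2 - y^3 < 1 - 7 * x - x^2 - x^3 \<longleftrightarrow> x < y"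
  using multiplier_strict_antimono[of x y] multiplier_strict_antimono[of y x]
  by (cases x y rule: linorder_cases) auto

lemma multiplier_eq_iff:
  fixes x y :: real
  shows "1 - 7 * x - x^2 - x^3 = 1 - 7 * y - y^2 - y^3 \<longleftrightarrow> x = y"
  using multiplier_strict_antimono[of x y] multiplier_strict_antimono[of y x]
  by (cases x y rule: linorder_cases) auto

text \<open>Cardano: the shift by \<open>-1/3\<close> removes the square term, so \<beta> is
  \<open>-1/3 + (T - 80 / T) / 6\<close>, where \<open>S = T^3\<close> is the positive root of the
  resolvent \<open>S^2 - 920 * S - 80^3\<close>.\<close>

lemma \<delta>\<^sub>n\<^sub>h_root:
  obtains \<beta> where "\<delta>\<^sub>n\<^sub>h = \<beta>^2" "1 - 7 * \<beta> - \<beta>^2 - \<beta>^3 = -1"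
proof -
  define S where "S = 460 + 60 * sqrt 201"
  define T where "T = S powr (1/3)"
  define \<beta> where "\<beta> = (T^2 - 2 * T - 80) / (6 * T)"
  have "S > 0" by (simp add: S_def add_pos_nonneg)
  then have T: "T > 0" "T^3 = S" "S powr (2/3) = T^2"
    by (simp_all add: T_def powr_powr flip: powr_numeral)
  have S2: "S^2 = 920 * S + 512000"
    by (simp add: S_def power2_eq_square algebra_simps)
  have \<beta>T: "6 * T * \<beta> = T^2 - 2 * T - 80" using T(1) by (simp add: \<beta>_def)
  \<comment> \<open>The factor \<open>216 * T^3 = (6 * T)^3\<close> clears denominators, so that
    \<beta> enters only through \<open>6 * T * \<beta>\<close>.\<close>
  have "216 * T^3 * (\<beta>^3 + \<beta>^2 + 7 * \<beta> - 2) =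
      (6 * T * \<beta>)^3 + 6 * T * (6 * T * \<beta>)^2 + 252 * T^2 * (6 * T * \<beta>) - 432 * T^3"
    by (simp add: algebra_simps power2_eq_square power3_eq_cube)
  also have "\<dots> = (T^3)^2 - 920 * T^3 - 512000"
    unfolding \<beta>T by (simp add: algebra_simps power2_eq_square power3_eq_cube)
  also have "\<dots> = 0" using S2 by (simp add: T(2))
  finally have "1 - 7 * \<beta> - \<beta>^2 - \<beta>^3 = -1" using T(1) by simp
  moreover have "\<delta>\<^sub>n\<^sub>h = \<beta>^2"
    unfolding \<delta>\<^sub>n\<^sub>h_def S_def[symmetric] T(3) T_def[symmetric] \<beta>_def
    by (simp add: power_divide power_mult_distrib)
  ultimately show thesis using that by blast
qed

theorem lemma2p5:
  fixes a b c \<delta> :: real and g :: "real \<Rightarrow> real"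
  assumes "a \<noteq> 0"
    and "g = (\<lambda>x. a * x\<^sup>2 + b * x + c)"
    and "\<delta> = b\<^sup>2 - 4 * a * c - 2 * b - 7"
    and "\<delta> \<ge> 0"
  shows "(\<delta> = 0 \<longrightarrow> nonhyperbolic_cycle g (C_cycle g a b 0)) \<and>
    (\<delta> > 0 \<longrightarrow>
       hyperbolic_cycle g (C_cycle g a b (- \<delta>)) \<and>
       (nonhyperbolic_cycle g (C_cycle g a b \<delta>) \<longleftrightarrow> \<delta> = \<delta>\<^sub>n\<^sub>h)) \<and>
    \<bar>\<delta>\<^sub>n\<^sub>h - 0.074\<bar> < 0.0005"
proof (intro conjI impI)
  obtain \<gamma> where \<gamma>: "\<delta>\<^sub>n\<^sub>h = \<gamma>^2" "1 - 7 * \<gamma> - \<gamma>^2 - \<gamma>^3 = -1" by (rule \<delta>\<^sub>n\<^sub>h_root)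
  \<comment> \<open>The decreasing multiplier is above -1 at 0.272 and below -1 at 0.2725; the
    squares of both bounds lie within 0.0005 of 0.074.\<close>
  have lower: "0.272 < \<gamma>"
    by (rule iffD1[OF multiplier_less_iff], unfold \<gamma>(2)) (simp add: power2_eq_square power3_eq_cube)
  have upper: "\<gamma> < 0.2725"
    by (rule iffD1[OF multiplier_less_iff], unfold \<gamma>(2)) (simp add: power2_eq_square power3_eq_cube)
  have "0.272^2 < \<gamma>^2" "\<gamma>^2 < 0.2725^2"
    using lower upper by (intro power_strict_mono; simp)+
  then show "\<bar>\<delta>\<^sub>n\<^sub>h - 0.074\<bar> < 0.0005"
    unfolding \<gamma>(1) by (simp add: power2_eq_square abs_if)
  note iff = C_cycle_hyperbolic_iff[OF assms(1), of _ b c, folded assms(2,3)]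
  show "nonhyperbolic_cycle g (C_cycle g a b 0)" if "\<delta> = 0"
    using iff[of 0] that by (simp add: nonhyperbolic_cycle_def)
  assume pos: "\<delta> > 0"
  define \<beta> where "\<beta> = sqrt \<delta>"
  have \<beta>: "\<beta> > 0" "\<delta> = \<beta>^2" using pos by (simp_all add: \<beta>_def)
  \<comment> \<open>The multiplier is 1 at 0, hence exceeds 1 at negative arguments.\<close>
  have "1 - 7 * (-\<beta>) - (-\<beta>)^2 - (-\<beta>)^3 > 1"
    using multiplier_strict_antimono[of "-\<beta>" 0] \<beta>(1) by simp
  then show "hyperbolic_cycle g (C_cycle g a b (- \<delta>))"
    using iff(2)[of "-\<delta>"] pos by (simp add: \<beta>_def[symmetric])
  have "nonhyperbolic_cycle g (C_cycle g a b \<delta>) \<longleftrightarrow> \<bar>1 - 7 * \<beta> - \<beta>^2 - \<beta>^3\<bar> = 1"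
    using iff[of \<delta>] pos by (simp add: nonhyperbolic_cycle_def \<beta>_def[symmetric])
  \<comment> \<open>For positive \<beta> the multiplier is below 1, so modulus 1 leaves only
    -1.\<close>
  also have "\<dots> \<longleftrightarrow> 1 - 7 * \<beta> - \<beta>^2 - \<beta>^3 = -1"
    using multiplier_strict_antimono[OF \<beta>(1)] by (auto simp: abs_if)
  also have "\<dots> \<longleftrightarrow> \<beta> = \<gamma>"
    using multiplier_eq_iff[of \<beta> \<gamma>] \<gamma>(2) by simp
  \<comment> \<open>Both \<beta> and \<gamma> are positive, so equal squares force equality.\<close>
  also have "\<dots> \<longleftrightarrow> \<delta> = \<delta>\<^sub>n\<^sub>h"
    unfolding \<gamma>(1) \<beta>(2) using \<beta>(1) lower by (simp add: power2_eq_iff_nonneg)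
  finally show "nonhyperbolic_cycle g (C_cycle g a b \<delta>) \<longleftrightarrow> \<delta> = \<delta>\<^sub>n\<^sub>h" .
qed

end
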